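(* Let $M,K,S\ge1$ be integers, $\sigma^2>0$, $\mathrm{EVM}\in(0,1]$, $\kappa=1-\mathrm{EVM}^2$, and for each $\nu=0,\dots,S-1$ let $\bar{\mathbf H}[\nu]=[\bar{\mathbf h}_1[\nu],\dots,\bar{\mathbf h}_K[\nu]]\in\mathbb{C}^{M\times K}$ have rank $K$. For $P_{\mathrm{tot}}>0$ let $R_\Sigma^{\mathrm{DL,DPC}}(P_{\mathrm{tot}})$ be the downlink sum rate with dirty paper coding under hardware distortion and optimal power allocation with total power $P_{\mathrm{tot}}$, as defined in the context. Then $$\lim_{P_{\mathrm{tot}}\to\infty}R_\Sigma^{\mathrm{DL,DPC}}(P_{\mathrm{tot}})=K\log_2\Big(\frac1{\mathrm{EVM}^2}\Big).$$
   Context: $(\cdot)^{\mathrm H}$ denotes the conjugate transpose. Downlink model: on subcarrier $\nu$ the $M$-antenna base station transmits $\sum_{i=1}^K\mathbf p_i[\nu]d_i[\nu]$, where $\mathbf p_i[\nu]\in\mathbb{C}^M$ is the precoding vector of user $i$ and the $d_i[\nu]$ are independent unit-variance data signals. With ideal hardware user $k$ would receive $y_k^{\mathrm{ideal}}[\nu]=\sum_{i}\bar{\mathbf h}_k[\nu]^{\mathrm H}\mathbf p_i[\nu]d_i[\nu]+n_k[\nu]$, with noise $n_k[\nu]\sim\mathcal{CN}(0,\sigma^2)$. With hardware distortion at the users, user $k$ receives $\sqrt{\kappa}\,y_k^{\mathrm{ideal}}[\nu]+\eta_k[\nu]$, where $\eta_k[\nu]$ is uncorrelated with $y_k^{\mathrm{ideal}}[\nu]$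 and has variance $(1-\kappa)\mathbb{E}|y_k^{\mathrm{ideal}}[\nu]|^2=(1-\kappa)\big(\sum_{i=1}^K|\bar{\mathbf h}_k[\nu]^{\mathrm H}\mathbf p_i[\nu]|^2+\sigma^2\big)$; the distortion is treated as Gaussian noise. Dirty paper coding (DPC): the users are encoded successively on each subcarrier according to a permutation $\pi_\nu$ of $\{1,\dots,K\}$ ($\pi_\nu(i)$ is the position of user $i$), and the data interference caused to user $k$ by users encoded earlier is perfectly pre-cancelled, while the distortion (proportional to the total received power) is not. The resulting rate of user $k$ on subcarrier $\nu$ is $\log_2(1+\mathrm{SINR}_k[\nu])$ with $$\mathrm{SINR}_k[\nu]=\frac{\kappa|\bar{\mathbf h}_k[\nu]^{\mathrm H}\mathbf p_k[\nu]|^2}{\sum_{i:\pi_\nu(i)>\pi_\nu(k)}|\bar{\mathbf h}_k[\nu]^{\mathrm H}\mathbf p_i[\nu]|^2+(1-\kappa)\sum_{i:\pi_\nu(i)\le\pi_\nu(k)}|\bar{\mathbf h}_k[\nu]^{\mathrm H}\mathbf p_i[\nu]|^2+\sigma^2}.$$ $R_\Sigma^{\mathrm{DL,DPC}}(P_{\mathrm{tot}})$ is the maximum of $\frac1S\sum_{\nu=0}^{S-1}\sum_{k=1}^K\log_2(1+\mathrm{SINR}_k[\nu])$ over all encoding orders $\pi_\nu$ and all precoding vectors satisfying $\sum_{\nu=0}^{S-1}\sum_{i=1}^K\|\mathbf p_i[\nu]\|^2\le P_{\mathrm{tot}}$. *)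

theory Defs
  imports "HOL-Analysis.Analysis"
begin

text \<open>
  The finite types \<open>'m\<close>, \<open>'k\<close>, \<open>'s\<close> index the \<open>M\<close> antennas, the \<open>K\<close> users and the \<open>S\<close> subcarriers.
  For subcarrier \<open>\<nu>\<close>, \<open>H \<nu>\<close> is the \<open>M \<times> K\<close> channel matrix whose \<open>k\<close>-th column is the channel vector of
  user \<open>k\<close>, \<open>p $ \<nu> $ i\<close> is the precoding vector of user \<open>i\<close>, and \<open>ord \<nu> i\<close> is the position of
  user \<open>i\<close> in the encoding order.
\<close>

text \<open>\<open>x\<^sup>H y\<close>; the library inner product on complex vectors is only the real part of this.\<close>

definition hprod :: "complex ^ 'm \<Rightarrow> complex ^ 'm \<Rightarrow> complex" where
  "hprod x y = (\<Sum>j\<in>UNIV. cnj (x $ j) * y $ j)"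

definition rx_power ::
  "('s::finite \<Rightarrow> complex ^ 'k ^ 'm) \<Rightarrow> complex ^ 'm ^ 'k ^ 's \<Rightarrow> 's \<Rightarrow> 'k \<Rightarrow> 'k \<Rightarrow> real" where
  "rx_power H p \<nu> k i = (cmod (hprod (column k (H \<nu>)) (p $ \<nu> $ i)))\<^sup>2"

definition dpc_sinr ::
  "('s::finite \<Rightarrow> complex ^ 'k ^ 'm) \<Rightarrow> real \<Rightarrow> real \<Rightarrow> ('s \<Rightarrow> 'k \<Rightarrow> nat) \<Rightarrow>
   complex ^ 'm ^ 'k ^ 's \<Rightarrow> 's \<Rightarrow> 'k \<Rightarrow> real" where
  "dpc_sinr H \<kappa> \<sigma> ord p \<nu> k =
     \<kappa> * rx_power H p \<nu> k k /
     ((\<Sum>i | ord \<nu> i > ord \<nu> k. rx_power H p \<nu> k i)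
      + (1 - \<kappa>) * (\<Sum>i | ord \<nu> i \<le> ord \<nu> k. rx_power H p \<nu> k i)
      + \<sigma>\<^sup>2)"

definition dpc_sum_rate ::
  "('s::finite \<Rightarrow> complex ^ 'k ^ 'm) \<Rightarrow> real \<Rightarrow> real \<Rightarrow> ('s \<Rightarrow> 'k \<Rightarrow> nat) \<Rightarrow>
   complex ^ 'm ^ 'k ^ 's \<Rightarrow> real" where
  "dpc_sum_rate H \<kappa> \<sigma> ord p =
     1 / real CARD('s) * (\<Sum>\<nu>\<in>UNIV. \<Sum>k\<in>UNIV. log 2 (1 + dpc_sinr H \<kappa> \<sigma> ord p \<nu> k))"

definition encoding_order :: "('s \<Rightarrow> 'k::finite \<Rightarrow> nat) \<Rightarrow> bool" where
  "encoding_order ord \<longleftrightarrow> (\<forall>\<nu>. bij_betw (ord \<nu>) UNIV {1..CARD('k)})"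

definition total_power :: "complex ^ 'm ^ 'k ^ 's \<Rightarrow> real" where
  "total_power p = (\<Sum>\<nu>\<in>UNIV. \<Sum>i\<in>UNIV. (norm (p $ \<nu> $ i))\<^sup>2)"

text \<open>\<open>GREATEST\<close> denotes a genuine maximum and is unspecified if none is attained.\<close>

definition R_dl_dpc ::
  "('s::finite \<Rightarrow> complex ^ 'k ^ 'm) \<Rightarrow> real \<Rightarrow> real \<Rightarrow> real \<Rightarrow> real" where
  "R_dl_dpc H \<kappa> \<sigma> P =
     (GREATEST r. \<exists>ord p. encoding_order ord \<and> total_power p \<le> P \<and> r = dpc_sum_rate H \<kappa> \<sigma> ord p)"

end

theory Submission
  imports Defs "HOL-Real_Asymp.Real_Asymp"
begin

text \<open>
  Discarding the interference and the noise bounds every SINR by \<open>\<kappa> / (1 - \<kappa>)\<close>, hence every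
  user's rate by \<open>log 2 (1 / EVM\<^sup>2)\<close>, for any order and any precoders. Conversely, since the channel
  matrices have full column rank, zero-forcing precoders exist; scaling them up removes the effect
  of the noise, and the bound is approached as the power grows. The maximum over precoders is
  attained by compactness of the ball that the power constraint cuts out.
\<close>

lemma rx_power_nonneg: "0 \<le> rx_power H p \<nu> k i"
  by (simp add: rx_power_def)

lemma continuous_on_hprod [continuous_intros]:
  "continuous_on A f \<Longrightarrow> continuous_on A (\<lambda>p. hprod x (f p))"
  unfolding hprod_def by (intro continuous_intros)

lemma continuous_on_rx_power [continuous_intros]:
  "continuous_on A (\<lambda>p. rx_power H p \<nu> k i)"
  unfolding rx_power_def by (intro continuous_intros)

text \<open>User \<open>k\<close> is itself among the users with
  \<open>ord \<nu> i \<le> ord \<nu> k\<close>, so its own distortion survives in the denominator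
  whatever the order; every other term is nonnegative.\<close>

lemma dpc_sinr_denominator_ge:
  fixes ord :: "'s::finite \<Rightarrow> 'k::finite \<Rightarrow> nat"
  assumes "\<kappa> \<le> 1"
  shows "(1 - \<kappa>) * rx_power H p \<nu> k k + \<sigma>\<^sup>2 \<le>
    (\<Sum>i | ord \<nu> i > ord \<nu> k. rx_power H p \<nu> k i)
      + (1 - \<kappa>) * (\<Sum>i | ord \<nu> i \<le> ord \<nu> k. rx_power H p \<nu> k i) + \<sigma>\<^sup>2"
proof -
  have "rx_power H p \<nu> k k \<le> (\<Sum>i | ord \<nu> i \<le> ord \<nu> k. rx_power H p \<nu> k i)"
    by (rule member_le_sum) (auto simp: rx_power_nonneg)
  then have "(1 - \<kappa>) * rx_power H p \<nu> k k \<le> (1 - \<kappa>) * (\<Sum>i | ord \<nu> i \<le> ord \<nu> k. rx_power H p \<nu> k i)"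
    using assms by (intro mult_left_mono) auto
  moreover have "0 \<le> (\<Sum>i | ord \<nu> i > ord \<nu> k. rx_power H p \<nu> k i)"
    by (intro sum_nonneg rx_power_nonneg)
  ultimately show ?thesis by linarith
qed

lemma dpc_sinr_denominator_pos:
  fixes ord :: "'s::finite \<Rightarrow> 'k::finite \<Rightarrow> nat"
  assumes "\<kappa> \<le> 1" "\<sigma>\<^sup>2 > 0"
  shows "0 < (\<Sum>i | ord \<nu> i > ord \<nu> k. rx_power H p \<nu> k i)
      + (1 - \<kappa>) * (\<Sum>i | ord \<nu> i \<le> ord \<nu> k. rx_power H p \<nu> k i) + \<sigma>\<^sup>2"
proof -
  have "0 \<le> (1 - \<kappa>) * rx_power H p \<nu> k k"
    using assms by (simp add: rx_power_nonneg)
  with dpc_sinr_denominator_ge[OF assms(1), of H p \<nu> k \<sigma> ord] assms(2) show ?thesis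
    by linarith
qed

lemma dpc_sinr_nonneg:
  fixes ord :: "'s::finite \<Rightarrow> 'k::finite \<Rightarrow> nat"
  assumes "0 \<le> \<kappa>" "\<kappa> \<le> 1" "\<sigma>\<^sup>2 > 0"
  shows "0 \<le> dpc_sinr H \<kappa> \<sigma> ord p \<nu> k"
  unfolding dpc_sinr_def
  using dpc_sinr_denominator_pos[OF assms(2,3)] assms(1)
  by (intro divide_nonneg_pos mult_nonneg_nonneg rx_power_nonneg) auto

text \<open>A user's own distortion grows in proportion to its own signal, so extra power cannot
  push the ratio beyond \<open>\<kappa> / (1 - \<kappa>)\<close>. The summand 1 is included because
  \<open>1 + dpc_sinr\<close> is the argument of the logarithm.\<close>

lemma dpc_sinr_le:
  fixes ord :: "'s::finite \<Rightarrow> 'k::finite \<Rightarrow> nat"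
  assumes "0 \<le> \<kappa>" "\<kappa> < 1" "\<sigma>\<^sup>2 > 0"
  shows "1 + dpc_sinr H \<kappa> \<sigma> ord p \<nu> k \<le> 1 / (1 - \<kappa>)"
proof -
  let ?a = "rx_power H p \<nu> k k"
  have nn: "0 \<le> (1 - \<kappa>) * ?a"
    using assms by (simp add: rx_power_nonneg)
  then have pos: "0 < (1 - \<kappa>) * ?a + \<sigma>\<^sup>2"
    using assms by linarith
  have "dpc_sinr H \<kappa> \<sigma> ord p \<nu> k \<le> \<kappa> * ?a / ((1 - \<kappa>) * ?a + \<sigma>\<^sup>2)"
    unfolding dpc_sinr_def
    using assms pos dpc_sinr_denominator_ge[of \<kappa> H p \<nu> k \<sigma> ord]
    by (intro divide_left_mono mult_pos_pos mult_nonneg_nonneg rx_power_nonneg) auto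
  \<comment> \<open>The noise is dropped here. Cross-multiplying, rather than cancelling
    \<open>?a\<close>, also covers \<open>?a = 0\<close>.\<close>
  also have "\<dots> \<le> \<kappa> / (1 - \<kappa>)"
    using assms pos by (simp add: divide_le_eq le_divide_eq field_simps)
  also have "\<dots> = 1 / (1 - \<kappa>) - 1"
    using assms by (simp add: field_simps)
  finally show ?thesis by linarith
qed

lemma dpc_sum_rate_le:
  fixes H :: "'s::finite \<Rightarrow> complex ^ 'k::finite ^ 'm::finite"
  assumes "0 \<le> \<kappa>" "\<kappa> < 1" "\<sigma>\<^sup>2 > 0"
  shows "dpc_sum_rate H \<kappa> \<sigma> ord p \<le> real CARD('k) * log 2 (1 / (1 - \<kappa>))"
proof -
  have "log 2 (1 + dpc_sinr H \<kappa> \<sigma> ord p \<nu> k) \<le> log 2 (1 / (1 - \<kappa>))" for \<nu> k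
    using dpc_sinr_le[OF assms, of H ord p \<nu> k] dpc_sinr_nonneg[of \<kappa> \<sigma> H ord p \<nu> k] assms
    by (intro log_mono) auto
  then have "(\<Sum>\<nu>\<in>UNIV. \<Sum>k\<in>UNIV. log 2 (1 + dpc_sinr H \<kappa> \<sigma> ord p \<nu> k))
    \<le> (\<Sum>\<nu>\<in>(UNIV::'s set). \<Sum>k\<in>(UNIV::'k set). log 2 (1 / (1 - \<kappa>)))"
    by (intro sum_mono)
  also have "\<dots> = real CARD('s) * (real CARD('k) * log 2 (1 / (1 - \<kappa>)))"
    by simp
  finally show ?thesis
    by (simp add: dpc_sum_rate_def divide_le_eq mult.commute)
qed

text \<open>The norm of a nested vector is Euclidean at every level, so the power constraint
  describes a closed Euclidean ball, which is compact.\<close>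

lemma total_power_eq_norm: "total_power p = (norm p)\<^sup>2"
  by (simp add: total_power_def norm_vec_def L2_set_def sum_nonneg)

lemma finite_encoding_orders: "finite {ord :: 's::finite \<Rightarrow> 'k::finite \<Rightarrow> nat. encoding_order ord}"
proof -
  let ?F = "PiE (UNIV::'k set) (\<lambda>_. {1..CARD('k)})"
  have "finite (PiE (UNIV::'s set) (\<lambda>_. ?F))"
    by (intro finite_PiE) auto
  moreover have "{ord. encoding_order ord} \<subseteq> PiE (UNIV::'s set) (\<lambda>_. ?F)"
    by (auto simp: encoding_order_def PiE_iff dest: bij_betwE)
  ultimately show ?thesis
    by (rule rev_finite_subset)
qed

lemma encoding_order_exists: "\<exists>ord :: 's::finite \<Rightarrow> 'k::finite \<Rightarrow> nat. encoding_order ord"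
proof -
  obtain f where "bij_betw f (UNIV::'k set) {1..CARD('k)}"
    using finite_same_card_bij[of "UNIV::'k set" "{1..CARD('k)}"] by auto
  then have "encoding_order (\<lambda>_::'s. f)"
    by (simp add: encoding_order_def)
  then show ?thesis by blast
qed

text \<open>The noise keeps all denominators positive, and nonnegative SINRs keep the arguments of
  the logarithm at least 1.\<close>

lemma continuous_on_dpc_sum_rate:
  fixes H :: "'s::finite \<Rightarrow> complex ^ 'k::finite ^ 'm::finite"
  assumes "0 \<le> \<kappa>" "\<kappa> < 1" "\<sigma>\<^sup>2 > 0"
  shows "continuous_on A (dpc_sum_rate H \<kappa> \<sigma> ord)"
proof -
  have "continuous_on A (\<lambda>p. dpc_sinr H \<kappa> \<sigma> ord p \<nu> k)" for \<nu> k
    unfolding dpc_sinr_def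
    using dpc_sinr_denominator_pos[of \<kappa> \<sigma> H _ \<nu> k ord] assms
    by (intro continuous_intros ballI less_imp_neq[THEN not_sym]) auto
  moreover have "1 + dpc_sinr H \<kappa> \<sigma> ord p \<nu> k \<noteq> 0" for p \<nu> k
    using dpc_sinr_nonneg[of \<kappa> \<sigma> H ord p \<nu> k] assms by simp
  ultimately show ?thesis
    unfolding dpc_sum_rate_def by (intro continuous_intros ballI) auto
qed

text \<open>\<open>GREATEST\<close> says something only once a maximum is known to exist. The
  achievable rates form a finite union, over the encoding orders, of continuous images of a ball: a
  nonempty compact set of reals, which contains its supremum.\<close>

lemma R_dl_dpc_attained:
  fixes H :: "'s::finite \<Rightarrow> complex ^ 'k::finite ^ 'm::finite"
  assumes "0 \<le> \<kappa>" "\<kappa> < 1" "\<sigma>\<^sup>2 > 0" "0 \<le> P"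
  obtains ord p where "encoding_order ord" "total_power p \<le> P"
    "R_dl_dpc H \<kappa> \<sigma> P = dpc_sum_rate H \<kappa> \<sigma> ord p"
    "\<And>ord' p'. encoding_order ord' \<Longrightarrow> total_power p' \<le> P \<Longrightarrow>
      dpc_sum_rate H \<kappa> \<sigma> ord' p' \<le> R_dl_dpc H \<kappa> \<sigma> P"
proof -
  let ?B = "cball 0 (sqrt P) :: (complex ^ 'm ^ 'k ^ 's) set"
  define V where "V = (\<Union>ord \<in> {ord. encoding_order ord}. dpc_sum_rate H \<kappa> \<sigma> ord ` ?B)"
  have B: "p \<in> ?B \<longleftrightarrow> total_power p \<le> P" for p
    using real_sqrt_le_iff[of "(norm p)\<^sup>2" P] by (simp add: total_power_eq_norm)
  have "compact V"
    unfolding V_def using assms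
    by (intro compact_UN finite_encoding_orders compact_continuous_image
        continuous_on_dpc_sum_rate compact_cball) auto
  \<comment> \<open>As \<open>P\<close> is nonnegative, the ball contains its centre, the zero
    precoder.\<close>
  moreover have "V \<noteq> {}"
    using encoding_order_exists[where 's='s and 'k='k] assms(4) by (auto simp: V_def)
  ultimately obtain m where m: "m \<in> V" "\<And>r. r \<in> V \<Longrightarrow> r \<le> m"
    using compact_attains_sup[of V] by metis
  have V: "r \<in> V \<longleftrightarrow> (\<exists>ord p. encoding_order ord \<and> total_power p \<le> P \<and> r = dpc_sum_rate H \<kappa> \<sigma> ord p)" for r
    unfolding V_def UN_iff image_iff Bex_def mem_Collect_eq B by blast
  have R: "R_dl_dpc H \<kappa> \<sigma> P = m"
    unfolding R_dl_dpc_def V[symmetric] by (rule Greatest_equality) (fact m)+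
  obtain ord p where "encoding_order ord" "total_power p \<le> P" "m = dpc_sum_rate H \<kappa> \<sigma> ord p"
    using m(1) unfolding V by blast
  moreover have "dpc_sum_rate H \<kappa> \<sigma> ord' p' \<le> m" if "encoding_order ord'" "total_power p' \<le> P" for ord' p'
    using that by (intro m(2)) (auto simp: V)
  ultimately show ?thesis
    unfolding R[symmetric] by (rule that)
qed

text \<open>Full column rank yields a left inverse of \<open>A\<close>, whose conjugated rows serve
  as the precoders.\<close>

lemma zero_forcing_precoders:
  fixes A :: "complex ^ 'k::finite ^ 'm::finite"
  assumes "rank A = CARD('k)"
  shows "\<exists>q :: complex ^ 'm ^ 'k. \<forall>k i. hprod (column k A) (q $ i) = (if i = k then 1 else 0)"
proof -
  \<comment> \<open>\<open>rank\<close> is the dimension of the row space, which here equals that of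
    the whole space \<open>complex ^ 'k\<close>.\<close>
  have "vec.span (rows A) = UNIV"
    using assms unfolding row_rank_def_gen vec.dim_eq_full[symmetric] vec.dimension_def card_cart_basis .
  then obtain B where B: "B ** A = mat 1"
    unfolding matrix_left_invertible_span_rows_gen[symmetric] by blast
  \<comment> \<open>\<open>hprod\<close> conjugates the column of \<open>A\<close>; conjugating
    \<open>B\<close> as well makes the product the conjugate of an entry of
    \<open>B ** A\<close>.\<close>
  define q :: "complex ^ 'm ^ 'k" where "q = (\<chi> i j. cnj (B $ i $ j))"
  have "hprod (column k A) (q $ i) = cnj ((B ** A) $ i $ k)" for k i
    by (simp add: hprod_def q_def column_def matrix_matrix_mult_def mult.commute)
  then have "hprod (column k A) (q $ i) = (if i = k then 1 else 0)" for k i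
    by (simp add: B mat_def)
  then show ?thesis by blast
qed

text \<open>Each user receives only its own signal, with power \<open>t\<^sup>2\<close>. The order
  then has no influence, all SINRs coincide, and the average over subcarriers is trivial.\<close>

lemma zero_forcing_sum_rate:
  fixes H :: "'s::finite \<Rightarrow> complex ^ 'k::finite ^ 'm::finite" and t :: real
  assumes "\<And>\<nu> k i. hprod (column k (H \<nu>)) (q $ \<nu> $ i) = (if i = k then 1 else 0)"
  shows "dpc_sum_rate H \<kappa> \<sigma> ord (t *\<^sub>R q)
    = real CARD('k) * log 2 (1 + \<kappa> * t\<^sup>2 / ((1 - \<kappa>) * t\<^sup>2 + \<sigma>\<^sup>2))"
proof -
  have "hprod x (t *\<^sub>R y) = of_real t * hprod x y" for x y :: "complex ^ 'm"
    unfolding hprod_def sum_distrib_left vector_scaleR_component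
    by (rule sum.cong) (simp_all add: scaleR_conv_of_real[where 'a=complex])
  then have rx: "rx_power H (t *\<^sub>R q) \<nu> k i = (if i = k then t\<^sup>2 else 0)" for \<nu> k i
    by (simp add: rx_power_def assms norm_mult)
  have "dpc_sinr H \<kappa> \<sigma> ord (t *\<^sub>R q) \<nu> k = \<kappa> * t\<^sup>2 / ((1 - \<kappa>) * t\<^sup>2 + \<sigma>\<^sup>2)" for \<nu> k
    by (simp add: dpc_sinr_def rx)
  then show ?thesis
    by (simp add: dpc_sum_rate_def)
qed

theorem corollary1:
  fixes H :: "'s::finite \<Rightarrow> complex ^ 'k::finite ^ 'm::finite"
    and \<sigma> EVM \<kappa> :: real
  assumes "\<sigma>\<^sup>2 > 0"
    and "0 < EVM" and "EVM \<le> 1"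
    and "\<kappa> = 1 - EVM\<^sup>2"
    and "\<And>\<nu>. rank (H \<nu>) = CARD('k)"
  shows "((\<lambda>P. R_dl_dpc H \<kappa> \<sigma> P) \<longlongrightarrow> real CARD('k) * log 2 (1 / EVM\<^sup>2)) at_top"
proof -
  \<comment> \<open>\<open>EVM = 1\<close> gives \<open>\<kappa> = 0\<close>, while
    \<open>EVM > 0\<close> gives \<open>\<kappa> < 1\<close> and so a finite bound.\<close>
  have \<kappa>: "0 \<le> \<kappa>" "\<kappa> < 1" and EVM: "EVM\<^sup>2 = 1 - \<kappa>"
    using assms(2-4) by (auto simp: power_le_one)
  obtain Q :: "'s \<Rightarrow> complex ^ 'm ^ 'k" where
    Q: "\<And>\<nu> k i. hprod (column k (H \<nu>)) (Q \<nu> $ i) = (if i = k then 1 else 0)"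
    using zero_forcing_precoders[OF assms(5)] by metis
  define q where "q = (\<chi> \<nu>. Q \<nu>)"
  \<comment> \<open>The added 1 makes \<open>C\<close> positive and keeps
    \<open>(norm q)\<^sup>2 / C\<close> below 1, so that scaling \<open>q\<close> by
    \<open>sqrt (P / C)\<close> respects the power budget \<open>P\<close>.\<close>
  define C where "C = (norm q)\<^sup>2 + 1"
  obtain ord :: "'s \<Rightarrow> 'k \<Rightarrow> nat" where ord: "encoding_order ord"
    using encoding_order_exists by blast
  \<comment> \<open>The zero-forcing rate at \<open>t\<^sup>2 = P / C\<close>.\<close>
  let ?L = "\<lambda>P. real CARD('k) * log 2 (1 + \<kappa> * (P / C) / ((1 - \<kappa>) * (P / C) + \<sigma>\<^sup>2))"
  have C: "C > 0"
    by (simp add: C_def add_nonneg_pos)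
  have lower: "?L P \<le> R_dl_dpc H \<kappa> \<sigma> P" if "0 \<le> P" for P
  proof -
    have "total_power (sqrt (P / C) *\<^sub>R q) = P * ((norm q)\<^sup>2 / C)"
      using that C by (simp add: total_power_eq_norm power_mult_distrib)
    also have "\<dots> \<le> P"
      using that C by (intro mult_left_le) (simp_all add: C_def)
    finally have "dpc_sum_rate H \<kappa> \<sigma> ord (sqrt (P / C) *\<^sub>R q) \<le> R_dl_dpc H \<kappa> \<sigma> P"
      using R_dl_dpc_attained[OF \<kappa> assms(1) that] ord by metis
    moreover have "dpc_sum_rate H \<kappa> \<sigma> ord (sqrt (P / C) *\<^sub>R q) = ?L P"
      using that C by (subst zero_forcing_sum_rate) (simp_all add: q_def Q)
    ultimately show ?thesis by simp
  qed
  have upper: "R_dl_dpc H \<kappa> \<sigma> P \<le> real CARD('k) * log 2 (1 / EVM\<^sup>2)" if "0 \<le> P" for P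
    using R_dl_dpc_attained[OF \<kappa> assms(1) that] dpc_sum_rate_le[OF \<kappa> assms(1)] EVM by metis
  have "((\<lambda>P. \<kappa> * (P / C) / ((1 - \<kappa>) * (P / C) + \<sigma>\<^sup>2)) \<longlongrightarrow> \<kappa> / (1 - \<kappa>)) at_top"
  proof -
    have "((\<lambda>x. \<kappa> * x / ((1 - \<kappa>) * x + \<sigma>\<^sup>2)) \<longlongrightarrow> \<kappa> / (1 - \<kappa>)) at_top"
      using \<kappa> by (real_asymp simp: divide_inverse)
    moreover have "filterlim (\<lambda>P. P / C) at_top at_top"
      using C by real_asymp
    ultimately show ?thesis
      by (rule filterlim_compose)
  qed
  then have "(?L \<longlongrightarrow> real CARD('k) * log 2 (1 + \<kappa> / (1 - \<kappa>))) at_top"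
    using \<kappa> by (intro tendsto_mult tendsto_log tendsto_add tendsto_const) (simp_all add: add_pos_nonneg field_simps)
  also have "1 + \<kappa> / (1 - \<kappa>) = 1 / EVM\<^sup>2"
    using \<kappa> unfolding EVM by (simp add: field_simps)
  finally have lim: "(?L \<longlongrightarrow> real CARD('k) * log 2 (1 / EVM\<^sup>2)) at_top" .
  \<comment> \<open>Both bounds hold for \<open>P \<ge> 0\<close>, hence eventually, and the upper
    one is already the limit.\<close>
  show ?thesis
    by (rule tendsto_sandwich[OF
          eventually_mono[OF eventually_ge_at_top[of 0] lower]
          eventually_mono[OF eventually_ge_at_top[of 0] upper] lim tendsto_const])
qed

end
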